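(* Let $q$ be a prime power and let $U(n,q)\subseteq GL(n,q^2)$ be the finite unitary group acting naturally on $\mathbb{F}_{q^2}^n$. Let $g$ be chosen uniformly at random from $U(n,q)$ and let $Z_n$ be the number of vectors $v\in\mathbb{F}_{q^2}^n$ with $gv=v$. Then for every natural number $j$ and every $n\ge 2j$, $$E[Z_n^j]=\prod_{i=1}^{j}\left(q^{2i-1}+1\right).$$
   Context: $U(n,q)$ is the group of elements of $GL(n,q^2)$ preserving a nondegenerate Hermitian form on $\mathbb{F}_{q^2}^n$; an element with a $k$-dimensional fixed space has $q^{2k}$ fixed vectors. *)

theory Defs
  imports
    "HOL-Probability.Probability"
    "HOL-Number_Theory.Prime_Powers"
    "Jordan_Normal_Form.Matrix"
begin

text \<open>
  The field \<open>'a\<close> is meant to have \<open>q\<^sup>2\<close> elements; its involution is then \<open>x \<mapsto> x ^ q\<close>.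
  Forms are linear in the first and semilinear in the second argument, and are constrained
  only on \<open>carrier_vec n\<close>.
\<close>

definition hermitian_form :: "nat \<Rightarrow> nat \<Rightarrow> ('a::field vec \<Rightarrow> 'a vec \<Rightarrow> 'a) \<Rightarrow> bool" where
  "hermitian_form q n B \<longleftrightarrow>
     (\<forall>u\<in>carrier_vec n. \<forall>v\<in>carrier_vec n. \<forall>w\<in>carrier_vec n.
        B (u + v) w = B u w + B v w \<and> B w (u + v) = B w u + B w v) \<and>
     (\<forall>a. \<forall>v\<in>carrier_vec n. \<forall>w\<in>carrier_vec n.
        B (a \<cdot>\<^sub>v v) w = a * B v w \<and> B v (a \<cdot>\<^sub>v w) = a ^ q * B v w) \<and>
     (\<forall>v\<in>carrier_vec n. \<forall>w\<in>carrier_vec n. B w v = B v w ^ q)"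

definition nondegenerate_form :: "nat \<Rightarrow> ('a::field vec \<Rightarrow> 'a vec \<Rightarrow> 'a) \<Rightarrow> bool" where
  "nondegenerate_form n B \<longleftrightarrow>
     (\<forall>v\<in>carrier_vec n. (\<forall>w\<in>carrier_vec n. B v w = 0) \<longrightarrow> v = 0\<^sub>v n)"

definition unitary_group :: "nat \<Rightarrow> ('a::field vec \<Rightarrow> 'a vec \<Rightarrow> 'a) \<Rightarrow> 'a mat set" where
  "unitary_group n B =
     {g \<in> carrier_mat n n. invertible_mat g \<and>
        (\<forall>v\<in>carrier_vec n. \<forall>w\<in>carrier_vec n. B (g *\<^sub>v v) (g *\<^sub>v w) = B v w)}"

definition num_fixed_vectors :: "nat \<Rightarrow> 'a::field mat \<Rightarrow> nat" where
  "num_fixed_vectors n g = card {v \<in> carrier_vec n. g *\<^sub>v v = v}"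

end

(*
  For a subspace W of dimension k, let G_W be its pointwise stabilizer in the unitary group.
  Summing Z^(j+1) over G_W amounts to summing, over all vectors v, the sum of Z^j over the
  stabilizer of v in G_W, which is the pointwise stabilizer of W + <v>. Vectors of W contribute
  q^(2k) times the same sum for j. A vector v outside W contributes the j-th moment for dimension
  k+1 divided by the size of its orbit, so only the number of G_W-orbits outside W matters. By the
  one-step Witt theorem such an orbit is determined by the functional B(v, _) on W and the norm
  B(v, v), and for n >= 2(k+1) all q^(2k) * q pairs occur. The average N(j, k)
  of Z^j over G_W thus satisfies
  N(j+1, k) = q^(2k) N(j, k) + q^(2k+1) N(j, k+1), solved by
  N(j, k) = q^(2kj) * prod_(i=1..j) (1 + q^(2i-1)); the theorem is the case k = 0.
*)

theory Submission
  imports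
    Defs
    "Jordan_Normal_Form.Determinant"
    "Berlekamp_Zassenhaus.Berlekamp_Type_Based"
begin

section \<open>Counting and linear functionals\<close>

lemma card_fibres:
  assumes "finite S" and "\<And>y. y \<in> f ` S \<Longrightarrow> card {x \<in> S. f x = y} = c"
  shows "card S = c * card (f ` S)"
proof -
  have "card S = (\<Sum>y\<in>f ` S. card {x \<in> S. f x = y})"
    using sum.image_gen[OF assms(1), of "\<lambda>_. 1::nat" f] by simp
  also have "\<dots> = c * card (f ` S)"
    using assms(2) by simp
  finally show ?thesis .
qed

lemma card_fibres_le:
  assumes "finite S" "finite T" "f ` S \<subseteq> T" and "\<And>y. y \<in> T \<Longrightarrow> card {x \<in> S. f x = y} \<le> c"
  shows "card S \<le> c * card T"
proof -
  have "card S = (\<Sum>y\<in>T. card {x \<in> S. f x = y})"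
    using sum.group[OF assms(1-3), of "\<lambda>_. 1::nat"] by simp
  also have "\<dots> \<le> (\<Sum>y\<in>T. c)"
    by (intro sum_mono assms(4))
  finally show ?thesis by (simp add: mult.commute)
qed

text \<open>The equal weights on a fibre add up to 1, so the sum counts fibres. Once the fibres are
  identified with group orbits, this turns a sum over vectors into a number of orbits.\<close>

lemma sum_inverse_fibre_card:
  assumes "finite S"
  shows "(\<Sum>x\<in>S. 1 / real (card {y \<in> S. f y = f x})) = real (card (f ` S))"
proof -
  have "(\<Sum>x\<in>S. 1 / real (card {y \<in> S. f y = f x}))
      = (\<Sum>z\<in>f ` S. \<Sum>x\<in>{x \<in> S. f x = z}. 1 / real (card {y \<in> S. f y = f x}))"
    using assms by (rule sum.image_gen)
  also have "\<dots> = (\<Sum>z\<in>f ` S. 1)"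
  proof (intro sum.cong refl)
    fix z assume "z \<in> f ` S"
    then have "card {y \<in> S. f y = z} \<noteq> 0"
      using assms by auto
    then show "(\<Sum>x\<in>{x \<in> S. f x = z}. 1 / real (card {y \<in> S. f y = f x})) = 1"
      by simp
  qed
  finally show ?thesis by simp
qed

text \<open>One root bound serves three purposes: the fixed points of \<open>x ^ q\<close>, the
  fibres of the trace and, with \<open>m = q + 1\<close> and \<open>a = 0\<close>, the fibres of the
  norm. The bound on \<open>m\<close> keeps the linear part away from the leading
  coefficient.\<close>

lemma card_trinomial_roots_le:
  fixes a b :: "'a::idom"
  assumes "2 \<le> m"
  shows "card {x. x ^ m + a * x + b = 0} \<le> m"
proof -
  define p where "p = monom 1 m + [:b, a:]"
  have "degree p = m"
    unfolding p_def using assms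
    by (subst degree_add_eq_left) (auto simp: degree_monom_eq)
  moreover have "p \<noteq> 0"
    using calculation assms by auto
  moreover have "poly p x = x ^ m + a * x + b" for x
    by (simp add: p_def poly_monom algebra_simps)
  ultimately show ?thesis
    using card_poly_roots_bound[of p] by simp
qed

lemma smult_zero_vec: "(a :: 'a::comm_ring_1) \<cdot>\<^sub>v 0\<^sub>v n = 0\<^sub>v n"
  by (intro eq_vecI) auto

lemma linear_functional_expand:
  fixes f :: "'a::comm_ring_1 vec \<Rightarrow> 'a"
  assumes add: "\<And>u v. u \<in> carrier_vec n \<Longrightarrow> v \<in> carrier_vec n \<Longrightarrow> f (u + v) = f u + f v"
    and smult: "\<And>a v. v \<in> carrier_vec n \<Longrightarrow> f (a \<cdot>\<^sub>v v) = a * f v"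
    and x: "x \<in> carrier_vec n"
  shows "f x = (\<Sum>i<n. x $ i * f (unit_vec n i))"
proof -
  \<comment> \<open>Induction over the truncations of \<open>x\<close> to its first \<open>m\<close>
    coordinates.\<close>
  have "f (vec n (\<lambda>i. if i < m then x $ i else 0)) = (\<Sum>i<m. x $ i * f (unit_vec n i))"
    if "m \<le> n" for m
    using that
  proof (induction m)
    case 0
    have "vec n (\<lambda>i. 0) = 0 \<cdot>\<^sub>v (0\<^sub>v n :: 'a vec)"
      by (intro eq_vecI) auto
    then show ?case
      using smult[of "0\<^sub>v n" 0] by simp
  next
    case (Suc m)
    have "vec n (\<lambda>i. if i < Suc m then x $ i else 0)
        = vec n (\<lambda>i. if i < m then x $ i else 0) + x $ m \<cdot>\<^sub>v unit_vec n m"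
      using Suc.prems by (intro eq_vecI) (auto simp: less_Suc_eq)
    then show ?case
      using Suc by (simp add: add smult)
  qed
  moreover have "vec n (\<lambda>i. if i < n then x $ i else 0) = x"
    using x by (intro eq_vecI) auto
  ultimately show ?thesis
    by force
qed

section \<open>Hermitian spaces over finite fields\<close>

locale hermitian_space =
  fixes q n :: nat and B :: "'a::{field,finite} vec \<Rightarrow> 'a vec \<Rightarrow> 'a"
  assumes card_field: "CARD('a) = q ^ 2"
    and hermitian: "hermitian_form q n B"
    and nondegenerate: "nondegenerate_form n B"
    and n_pos: "0 < n"
begin

abbreviation V :: "'a vec set" where "V \<equiv> carrier_vec n"

lemma form_add_left: "\<lbrakk>u \<in> V; v \<in> V; w \<in> V\<rbrakk> \<Longrightarrow> B (u + v) w = B u w + B v w"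
  and form_add_right: "\<lbrakk>u \<in> V; v \<in> V; w \<in> V\<rbrakk> \<Longrightarrow> B w (u + v) = B w u + B w v"
  and form_smult_left: "\<lbrakk>v \<in> V; w \<in> V\<rbrakk> \<Longrightarrow> B (a \<cdot>\<^sub>v v) w = a * B v w"
  and form_smult_right: "\<lbrakk>v \<in> V; w \<in> V\<rbrakk> \<Longrightarrow> B v (a \<cdot>\<^sub>v w) = a ^ q * B v w"
  and form_conj: "\<lbrakk>v \<in> V; w \<in> V\<rbrakk> \<Longrightarrow> B w v = B v w ^ q"
  using hermitian unfolding hermitian_form_def by blast+

lemmas form_simps = form_add_left form_add_right form_smult_left form_smult_right

lemma q_ge_2: "2 \<le> q"
proof -
  have "card {0, 1 :: 'a} \<le> CARD('a)"
    by (intro card_mono) auto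
  then show ?thesis
    unfolding card_field by (cases "q = 0"; cases "q = 1") auto
qed

lemma form_zero_left: "w \<in> V \<Longrightarrow> B (0\<^sub>v n) w = 0"
  using form_smult_left[of "0\<^sub>v n" w 0] by (simp add: smult_zero_vec)

lemma form_zero_right: "w \<in> V \<Longrightarrow> B w (0\<^sub>v n) = 0"
  using form_smult_right[of w "0\<^sub>v n" 0] q_ge_2
  by (simp add: power_0_left smult_zero_vec)

lemma diff_add_cancel_vec: "\<lbrakk>u \<in> V; v \<in> V\<rbrakk> \<Longrightarrow> u - v + v = u"
  by (intro eq_vecI) auto

lemma add_diff_cancel_vec: "\<lbrakk>u \<in> V; v \<in> V\<rbrakk> \<Longrightarrow> u + v - v = u"
  by (intro eq_vecI) auto

lemma form_diff_left:
  assumes "u \<in> V" "v \<in> V" "w \<in> V"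
  shows "B (u - v) w = B u w - B v w"
proof -
  have "B (u - v + v) w = B (u - v) w + B v w"
    using assms by (intro form_add_left) auto
  then show ?thesis
    unfolding diff_add_cancel_vec[OF assms(1,2)] by simp
qed

lemma form_diff_right:
  assumes "u \<in> V" "v \<in> V" "w \<in> V"
  shows "B w (u - v) = B w u - B w v"
proof -
  have "B w (u - v + v) = B w (u - v) + B w v"
    using assms by (intro form_add_right) auto
  then show ?thesis
    unfolding diff_add_cancel_vec[OF assms(1,2)] by simp
qed

lemma zero_conj [simp]: "(0::'a) ^ q = 0"
  using q_ge_2 by (simp add: power_0_left)

lemma form_eq_zero_sym: "\<lbrakk>v \<in> V; w \<in> V\<rbrakk> \<Longrightarrow> B v w = 0 \<longleftrightarrow> B w v = 0"
  using q_ge_2 by (subst form_conj) auto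

text \<open>In positive dimension there is a nonzero unit vector, and nondegeneracy supplies a
  partner for it.\<close>

lemma form_nonzero: obtains v w where "v \<in> V" "w \<in> V" "B v w \<noteq> 0"
proof -
  have "unit_vec n 0 \<noteq> (0\<^sub>v n :: 'a vec)"
    using n_pos by (metis index_unit_vec(1) index_zero_vec(1) zero_neq_one)
  then show ?thesis
    using nondegenerate that unfolding nondegenerate_form_def by (metis unit_vec_carrier)
qed

text \<open>That \<open>x \<mapsto> x ^ q\<close> is an additive involution is read off from a nonzero value of the form.\<close>

lemma conj_add: "(a + b :: 'a) ^ q = a ^ q + b ^ q"
proof -
  obtain v w where vw: "v \<in> V" "w \<in> V" "B v w \<noteq> 0"
    by (rule form_nonzero)
  have "(a + b) ^ q * B v w = B v (a \<cdot>\<^sub>v w + b \<cdot>\<^sub>v w)"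
    using vw by (simp add: form_smult_right add_smult_distrib_vec[symmetric])
  also have "\<dots> = (a ^ q + b ^ q) * B v w"
    using vw by (simp add: form_simps algebra_simps)
  finally show ?thesis
    using vw(3) by simp
qed

lemma conj_conj: "(a ^ q) ^ q = (a :: 'a)"
proof -
  obtain v w where vw: "v \<in> V" "w \<in> V" "B v w \<noteq> 0"
    by (rule form_nonzero)
  \<comment> \<open>Rescaling makes the form take the value \<open>a\<close>; exchanging the two
    arguments twice then applies the involution twice.\<close>
  let ?u = "(a / B v w) \<cdot>\<^sub>v v"
  have "B ?u w = a"
    using vw by (simp add: form_simps)
  then show ?thesis
    using vw form_conj[of ?u w] form_conj[of w ?u] by (metis smult_carrier_vec)
qed

lemma conj_minus: "(- a :: 'a) ^ q = - (a ^ q)"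
  using conj_add[of a "- a"] by (simp add: eq_neg_iff_add_eq_0 add.commute)

section \<open>The fixed field of the involution, its trace and its norm\<close>

definition F :: "'a set" where "F = {c. c ^ q = c}"

lemma card_F_le: "card F \<le> q"
proof -
  have "F = {c. c ^ q + (- 1) * c + 0 = 0}"
    by (auto simp: F_def)
  then show ?thesis
    using card_trinomial_roots_le[OF q_ge_2, of "- 1 :: 'a" 0] by simp
qed

lemma trace_fibre_le: "card {r :: 'a. r + r ^ q = c} \<le> q"
proof -
  have "{r :: 'a. r + r ^ q = c} = {r. r ^ q + 1 * r + (- c) = 0}"
    by (auto simp: algebra_simps)
  then show ?thesis
    using card_trinomial_roots_le[OF q_ge_2, of 1 "- c"] by simp
qed

lemma trace_in_F: "r + r ^ q \<in> F"
  by (simp add: F_def conj_add conj_conj add.commute)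

text \<open>The trace maps the \<open>q ^ 2\<close> field elements into \<open>F\<close> with fibres
  of size at most \<open>q\<close>, so \<open>F\<close> has at least \<open>q\<close> elements; the
  root bound gives the other inequality.\<close>

lemma card_F: "card F = q"
proof -
  have "q ^ 2 \<le> q * card F"
    using card_fibres_le[of "UNIV :: 'a set" F "\<lambda>r. r + r ^ q" q] trace_fibre_le trace_in_F card_field
    by auto
  then have "q \<le> card F"
    using q_ge_2 by (simp add: power2_eq_square)
  then show ?thesis
    using card_F_le by simp
qed

text \<open>The previous count is tight: the \<open>q\<close> fibres over \<open>F\<close> have at
  most \<open>q\<close> elements each and together exhaust \<open>q ^ 2\<close> elements, so none of
  them can be smaller.\<close>

lemma card_trace_fibre:
  assumes "c \<in> F"
  shows "card {r. r + r ^ q = c} = q"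
proof (rule ccontr)
  assume "card {r. r + r ^ q = c} \<noteq> q"
  then have "card {r. r + r ^ q = c} < q"
    using trace_fibre_le[of c] by simp
  then have "(\<Sum>c\<in>F. card {r. r + r ^ q = c}) < (\<Sum>c\<in>F. q)"
    using trace_fibre_le assms by (intro sum_strict_mono_ex1) auto
  also have "\<dots> = CARD('a)"
    by (simp add: card_F card_field power2_eq_square)
  also have "\<dots> = (\<Sum>c\<in>F. card {r. r + r ^ q = c})"
    using sum.group[of "UNIV :: 'a set" F "\<lambda>r. r + r ^ q" "\<lambda>_. 1::nat"] trace_in_F
    by (simp add: image_subset_iff)
  finally show False by simp
qed

text \<open>Each value is taken at most \<open>q + 1\<close> times on the
  \<open>q ^ 2 - 1 = (q + 1) * (q - 1)\<close> nonzero elements. Hence at least \<open>q - 1\<close>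
  values occur, and these fill \<open>F - {0}\<close>.\<close>

lemma norm_surj:
  assumes "c \<in> F"
  obtains t where "t * t ^ q = c"
proof -
  have inF: "(\<lambda>t. t * t ^ q) ` (UNIV - {0}) \<subseteq> F - {0}"
    by (auto simp: F_def power_mult_distrib conj_conj)
  have "CARD('a) - 1 \<le> Suc q * card ((\<lambda>t :: 'a. t * t ^ q) ` (UNIV - {0}))"
  proof -
    have "card {t \<in> UNIV - {0 :: 'a}. t * t ^ q = y} \<le> Suc q" for y
    proof -
      have "card {t \<in> UNIV - {0 :: 'a}. t * t ^ q = y} \<le> card {t. t ^ Suc q + 0 * t + (- y) = 0}"
        by (intro card_mono) auto
      also have "\<dots> \<le> Suc q"
        using q_ge_2 by (intro card_trinomial_roots_le) auto
      finally show ?thesis .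
    qed
    then show ?thesis
      using card_fibres_le[of "UNIV - {0 :: 'a}" "(\<lambda>t. t * t ^ q) ` (UNIV - {0})" "\<lambda>t. t * t ^ q" "Suc q"]
      by (simp add: card_Diff_subset)
  qed
  moreover have "CARD('a) - 1 = Suc q * (q - 1)"
    using q_ge_2 by (simp add: card_field power2_eq_square algebra_simps)
  ultimately have "q - 1 \<le> card ((\<lambda>t :: 'a. t * t ^ q) ` (UNIV - {0}))"
    by (metis Suc_mult_le_cancel1)
  moreover have "card (F - {0}) = q - 1"
    using card_F by (subst card_Diff_subset) (auto simp: F_def)
  ultimately have "(\<lambda>t. t * t ^ q) ` (UNIV - {0}) = F - {0}"
    using inF by (intro card_seteq) auto
  then have image: "(\<lambda>t. t * t ^ q) ` (UNIV - {0}) = F - {0}" .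
  show ?thesis
  proof (cases "c = 0")
    case True
    then show ?thesis using that[of 0] by simp
  next
    case False
    then have "c \<in> (\<lambda>t. t * t ^ q) ` (UNIV - {0})"
      using assms image by simp
    then show ?thesis using that by blast
  qed
qed

lemma trace_surj:
  assumes "c \<in> F" and "s \<noteq> 0"
  obtains b where "b * s + (b * s) ^ q = c"
proof -
  have "{r. r + r ^ q = c} \<noteq> {}"
    using card_trace_fibre[OF assms(1)] q_ge_2 by force
  then obtain r where "r + r ^ q = c" by auto
  then show ?thesis
    using that[of "r / s"] assms(2) by simp
qed

lemma form_self_in_F: "v \<in> V \<Longrightarrow> B v v \<in> F"
  by (simp add: F_def flip: form_conj)

subsection \<open>Subspaces and orthogonal complements\<close>

definition is_subspace :: "'a vec set \<Rightarrow> bool" where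
  "is_subspace W \<longleftrightarrow> W \<subseteq> V \<and> 0\<^sub>v n \<in> W \<and> (\<forall>u\<in>W. \<forall>v\<in>W. u + v \<in> W) \<and> (\<forall>a. \<forall>v\<in>W. a \<cdot>\<^sub>v v \<in> W)"

definition perp :: "'a vec set \<Rightarrow> 'a vec set" where
  "perp W = {v \<in> V. \<forall>w\<in>W. B v w = 0}"

definition adjoin :: "'a vec set \<Rightarrow> 'a vec \<Rightarrow> 'a vec set" where
  "adjoin W v = (\<lambda>(a, w). a \<cdot>\<^sub>v v + w) ` (UNIV \<times> W)"

lemma subspace_carrier: "\<lbrakk>is_subspace W; w \<in> W\<rbrakk> \<Longrightarrow> w \<in> V"
  and subspace_zero: "is_subspace W \<Longrightarrow> 0\<^sub>v n \<in> W"
  and subspace_add: "\<lbrakk>is_subspace W; u \<in> W; w \<in> W\<rbrakk> \<Longrightarrow> u + w \<in> W"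
  and subspace_smult: "\<lbrakk>is_subspace W; w \<in> W\<rbrakk> \<Longrightarrow> a \<cdot>\<^sub>v w \<in> W"
  by (auto simp: is_subspace_def)

lemma diff_eq_add_smult: "\<lbrakk>u \<in> V; v \<in> V\<rbrakk> \<Longrightarrow> u - v = u + (- 1) \<cdot>\<^sub>v v"
  by (intro eq_vecI) auto

lemma subspace_diff: "\<lbrakk>is_subspace W; u \<in> W; w \<in> W\<rbrakk> \<Longrightarrow> u - w \<in> W"
  by (simp add: diff_eq_add_smult subspace_carrier subspace_add subspace_smult)

lemma subspace_finite: "is_subspace W \<Longrightarrow> finite W"
  by (auto simp: is_subspace_def intro: finite_subset)

lemma subspace_singleton_zero: "is_subspace {0\<^sub>v n}"
  by (auto simp: is_subspace_def smult_zero_vec)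

lemma subspace_carrier_vec: "is_subspace V"
  by (auto simp: is_subspace_def)

lemma card_V: "card V = q ^ (2 * n)"
  by (simp add: card_carrier_vec card_field power_mult)

lemma perp_carrier: "v \<in> perp W \<Longrightarrow> v \<in> V"
  by (simp add: perp_def)

lemma perp_form_left: "\<lbrakk>v \<in> perp W; w \<in> W\<rbrakk> \<Longrightarrow> B v w = 0"
  by (simp add: perp_def)

lemma perp_form_right: "\<lbrakk>v \<in> perp W; w \<in> W; w \<in> V\<rbrakk> \<Longrightarrow> B w v = 0"
  using form_eq_zero_sym perp_carrier perp_form_left by blast

lemma subspace_perp: "W \<subseteq> V \<Longrightarrow> is_subspace (perp W)"
  by (auto simp: is_subspace_def perp_def form_simps form_zero_left subset_iff)

text \<open>Rescaling a vector with nonzero value makes \<open>f\<close> surjective onto a field of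
  \<open>q ^ 2\<close> elements, and all its fibres are translates of the kernel.\<close>

lemma card_kernel:
  assumes "is_subspace W"
    and add: "\<And>u v. u \<in> W \<Longrightarrow> v \<in> W \<Longrightarrow> f (u + v) = f u + f v"
    and smult: "\<And>a v. v \<in> W \<Longrightarrow> f (a \<cdot>\<^sub>v v) = a * (f v :: 'a)"
    and nonzero: "w \<in> W" "f w \<noteq> 0"
  shows "card W = card {v \<in> W. f v = 0} * q ^ 2"
proof -
  have surj: "\<exists>u\<in>W. f u = y" for y
    using nonzero assms(1) by (intro bexI[of _ "(y / f w) \<cdot>\<^sub>v w"]) (auto simp: smult subspace_smult)
  have "card {v \<in> W. f v = y} = card {v \<in> W. f v = 0}" for y
  proof -
    obtain u where u: "u \<in> W" "f u = y"
      using surj by blast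
    have diff: "f (v - u) = f v - f u" if "v \<in> W" for v
      using that u(1) assms(1)
      by (simp add: diff_eq_add_smult subspace_carrier add smult subspace_smult)
    have "bij_betw (\<lambda>v. v - u) {v \<in> W. f v = y} {v \<in> W. f v = 0}"
    proof (rule bij_betw_byWitness[where f' = "\<lambda>v. v + u"])
      show "\<forall>v\<in>{v \<in> W. f v = y}. v - u + u = v"
        using u assms(1) by (auto simp: subspace_carrier diff_add_cancel_vec)
      show "\<forall>v\<in>{v \<in> W. f v = 0}. v + u - u = v"
        using u(1) assms(1) by (auto simp: subspace_carrier add_diff_cancel_vec)
      show "(\<lambda>v. v - u) ` {v \<in> W. f v = y} \<subseteq> {v \<in> W. f v = 0}"
        using u assms(1) by (auto simp: diff subspace_diff)
      show "(\<lambda>v. v + u) ` {v \<in> W. f v = 0} \<subseteq> {v \<in> W. f v = y}"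
        using u assms(1) by (auto simp: add subspace_add)
    qed
    then show ?thesis by (rule bij_betw_same_card)
  qed
  then have "card W = card {v \<in> W. f v = 0} * card (f ` W)"
    using subspace_finite[OF assms(1)] by (intro card_fibres) auto
  moreover have "f ` W = UNIV"
    using surj by (metis imageI UNIV_eq_I)
  ultimately show ?thesis
    by (simp add: card_field)
qed

text \<open>Double counting of the orthogonal pairs in \<open>W \<times> V\<close>; no bases or dimensions are needed.\<close>

lemma card_perp:
  assumes "is_subspace W"
  shows "card W * card (perp W) = card V"
proof -
  have fin: "finite W" "W \<subseteq> V"
    using assms subspace_finite by (auto simp: is_subspace_def)
  \<comment> \<open>Nonzero functionals vanish on the fraction \<open>1 / q ^ 2\<close> of the
    space. The factor \<open>q ^ 2\<close> stays on the side of the kernel throughout, which avoids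
    division.\<close>
  have left: "card W = card {w \<in> W. B w v = 0} * q ^ 2" if v: "v \<in> V" "v \<notin> perp W" for v
  proof -
    obtain w where "w \<in> W" "B v w \<noteq> 0"
      using v by (auto simp: perp_def)
    then have "w \<in> W" "B w v \<noteq> 0"
      using v fin form_eq_zero_sym[of v w] by auto
    then show ?thesis
      using that assms by (intro card_kernel) (auto simp: form_simps subspace_carrier)
  qed
  have left0: "{w \<in> W. B w v = 0} = W" if "v \<in> perp W" for v
    using that fin perp_form_right by blast
  have right: "card V = card {v \<in> V. B v w = 0} * q ^ 2" if w: "w \<in> W" "w \<noteq> 0\<^sub>v n" for w
  proof -
    obtain v where "v \<in> V" "B v w \<noteq> 0"
      using w fin nondegenerate form_eq_zero_sym unfolding nondegenerate_form_def by blast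
    then show ?thesis
      using that fin subspace_carrier_vec by (intro card_kernel) (auto simp: form_simps)
  qed
  have right0: "{v \<in> V. B v (0\<^sub>v n) = 0} = V"
    by (auto simp: form_zero_right)
  have "(\<Sum>v\<in>V. card {w \<in> W. B w v = 0}) = (\<Sum>w\<in>W. card {v \<in> V. B w v = 0})"
    using sum.swap_restrict[of V W "\<lambda>_ _. 1::nat" "\<lambda>v w. B w v = 0"] fin by simp
  also have "\<dots> = (\<Sum>w\<in>W. card {v \<in> V. B v w = 0})"
    using fin form_eq_zero_sym by (intro sum.cong arg_cong[where f = card]) auto
  finally have eq: "(\<Sum>v\<in>V. card {w \<in> W. B w v = 0} * q ^ 2) = (\<Sum>w\<in>W. card {v \<in> V. B v w = 0} * q ^ 2)"
    by (simp flip: sum_distrib_right)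
  have pV: "perp W \<subseteq> V" "finite (perp W)"
    by (auto simp: perp_def)
  have "(\<Sum>v\<in>V. card {w \<in> W. B w v = 0} * q ^ 2)
      = (\<Sum>v\<in>V - perp W. card {w \<in> W. B w v = 0} * q ^ 2) + (\<Sum>v\<in>perp W. card {w \<in> W. B w v = 0} * q ^ 2)"
    using pV by (intro sum.subset_diff) auto
  also have "\<dots> = (card V - card (perp W)) * card W + card (perp W) * card W * q ^ 2"
    using left left0 pV by (simp add: card_Diff_subset flip: left)
  finally have 1: "(\<Sum>v\<in>V. card {w \<in> W. B w v = 0} * q ^ 2)
    = (card V - card (perp W)) * card W + card (perp W) * card W * q ^ 2" .
  have "(\<Sum>w\<in>W. card {v \<in> V. B v w = 0} * q ^ 2)
      = card {v \<in> V. B v (0\<^sub>v n) = 0} * q ^ 2 + (\<Sum>w\<in>W - {0\<^sub>v n}. card {v \<in> V. B v w = 0} * q ^ 2)"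
    using fin subspace_zero[OF assms] by (intro sum.remove) auto
  also have "\<dots> = card V * q ^ 2 + (card W - 1) * card V"
    unfolding right0 using right subspace_zero[OF assms] fin by (simp add: card_Diff_subset flip: right)
  finally have 2: "(\<Sum>w\<in>W. card {v \<in> V. B v w = 0} * q ^ 2) = card V * q ^ 2 + (card W - 1) * card V" .
  have le: "card (perp W) \<le> card V" "1 \<le> card W"
    using pV fin subspace_zero[OF assms] by (auto intro!: card_mono simp: Suc_le_eq card_gt_0_iff)
  \<comment> \<open>Over the integers the truncated subtractions become genuine ones, and after
    cancellation both sides share the factor \<open>q ^ 2 - 1\<close>.\<close>
  have "(int (card V) - int (card (perp W))) * int (card W) + int (card (perp W)) * int (card W) * int q ^ 2
      = int ((card V - card (perp W)) * card W + card (perp W) * card W * q ^ 2)"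
    using le by (simp add: of_nat_diff)
  also have "\<dots> = int (card V * q ^ 2 + (card W - 1) * card V)"
    using eq 1 2 by simp
  also have "\<dots> = int (card V) * int q ^ 2 + (int (card W) - 1) * int (card V)"
    using le by (simp add: of_nat_diff)
  finally have "int (card W * card (perp W)) * (int q ^ 2 - 1) = int (card V) * (int q ^ 2 - 1)"
    by (simp add: algebra_simps)
  moreover have "int q ^ 2 - 1 \<noteq> 0"
    using q_ge_2 by (simp add: power2_eq_1_iff)
  ultimately show ?thesis
    using of_nat_eq_iff by fastforce
qed

text \<open>Symmetry of orthogonality gives one inclusion; applying \<open>card_perp\<close> to
  \<open>W\<close> and to \<open>perp W\<close> shows that both sides have the same size.\<close>

lemma perp_perp:
  assumes "is_subspace W"
  shows "perp (perp W) = W"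
proof (rule sym, rule card_seteq)
  have sub: "is_subspace (perp W)"
    using assms subspace_perp by (auto simp: is_subspace_def)
  show "finite (perp (perp W))"
    by (auto simp: perp_def)
  show "W \<subseteq> perp (perp W)"
    using assms perp_form_right by (auto simp: subspace_carrier perp_def)
  have "card W * card (perp W) = card (perp (perp W)) * card (perp W)"
    using card_perp[OF assms] card_perp[OF sub] by (simp add: mult.commute)
  moreover have "card (perp W) \<noteq> 0"
    using subspace_zero[OF sub] subspace_finite[OF sub] by auto
  ultimately show "card (perp (perp W)) \<le> card W"
    by simp
qed

text \<open>A usable form of the double complement: a vector outside \<open>W\<close> is detected by
  some vector orthogonal to \<open>W\<close>. It replaces arguments with bases.\<close>

lemma obtain_perp:
  assumes "is_subspace W" "v \<in> V" "v \<notin> W"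
  obtains e where "e \<in> perp W" "B e v \<noteq> 0"
proof -
  have "v \<notin> perp (perp W)"
    using assms perp_perp by simp
  then obtain e where "e \<in> perp W" "B v e \<noteq> 0"
    using assms(2) by (auto simp: perp_def)
  then show ?thesis
    using that form_eq_zero_sym assms(2) perp_carrier by blast
qed

section \<open>Enlarging a subspace by one vector\<close>

lemma adjoinI: "w \<in> W \<Longrightarrow> a \<cdot>\<^sub>v v + w \<in> adjoin W v"
  by (auto simp: adjoin_def)

lemma adjoin_superset: "\<lbrakk>is_subspace W; v \<in> V; w \<in> W\<rbrakk> \<Longrightarrow> w \<in> adjoin W v"
proof -
  assume *: "is_subspace W" "v \<in> V" "w \<in> W"
  then have "w \<in> V"
    by (intro subspace_carrier)
  then have "0 \<cdot>\<^sub>v v + w = w"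
    using * by (intro eq_vecI) auto
  then show ?thesis
    using adjoinI[of w W 0 v] * by simp
qed

lemma adjoin_member: "\<lbrakk>is_subspace W; v \<in> V\<rbrakk> \<Longrightarrow> v \<in> adjoin W v"
  using adjoinI[of "0\<^sub>v n" W 1 v] subspace_zero by simp

lemma subspace_adjoin:
  assumes "is_subspace W" "v \<in> V"
  shows "is_subspace (adjoin W v)"
  unfolding is_subspace_def
proof (intro conjI ballI allI)
  show "adjoin W v \<subseteq> V"
    using assms subspace_carrier by (auto simp: adjoin_def)
  show "0\<^sub>v n \<in> adjoin W v"
    using assms by (intro adjoin_superset subspace_zero)
next
  fix x y assume "x \<in> adjoin W v" "y \<in> adjoin W v"
  then obtain a b u w where *: "x = a \<cdot>\<^sub>v v + u" "y = b \<cdot>\<^sub>v v + w" "u \<in> W" "w \<in> W"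
    by (auto simp: adjoin_def)
  then have "u \<in> V" "w \<in> V"
    using assms subspace_carrier by auto
  then have "x + y = (a + b) \<cdot>\<^sub>v v + (u + w)"
    unfolding * using assms by (intro eq_vecI) (auto simp: algebra_simps)
  then show "x + y \<in> adjoin W v"
    using * assms by (simp add: adjoinI subspace_add)
next
  fix c x assume "x \<in> adjoin W v"
  then obtain a u where *: "x = a \<cdot>\<^sub>v v + u" "u \<in> W"
    by (auto simp: adjoin_def)
  then have "u \<in> V"
    using assms subspace_carrier by auto
  then have "c \<cdot>\<^sub>v x = (c * a) \<cdot>\<^sub>v v + c \<cdot>\<^sub>v u"
    unfolding * using assms by (intro eq_vecI) (auto simp: algebra_simps)
  then show "c \<cdot>\<^sub>v x \<in> adjoin W v"
    using * assms by (simp add: adjoinI subspace_smult)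
qed

lemma card_adjoin:
  assumes W: "is_subspace W" and v: "v \<in> V" "v \<notin> W"
  shows "card (adjoin W v) = q ^ 2 * card W"
proof -
  have "inj_on (\<lambda>(a, w). a \<cdot>\<^sub>v v + w) (UNIV \<times> W)"
  proof (intro inj_onI, clarify)
    fix a b u w assume *: "u \<in> W" "w \<in> W" "a \<cdot>\<^sub>v v + u = b \<cdot>\<^sub>v v + w"
    \<comment> \<open>Pairing with \<open>e\<close> kills the components in \<open>W\<close> and
      isolates the coefficient of \<open>v\<close>.\<close>
    obtain e where e: "e \<in> perp W" "B e v \<noteq> 0"
      using obtain_perp[OF W v] by blast
    have eV: "e \<in> V" "u \<in> V" "w \<in> V"
      using e perp_carrier * W subspace_carrier by auto
    have "B (a \<cdot>\<^sub>v v + u) e = B (b \<cdot>\<^sub>v v + w) e"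
      using *(3) by simp
    moreover have "B v e \<noteq> 0"
      using e(2) form_eq_zero_sym[OF eV(1) v(1)] by simp
    ultimately have "a = b"
      using eV v(1) *(1,2) e(1) by (simp add: form_simps perp_form_right)
    have "u = (a \<cdot>\<^sub>v v + u) - a \<cdot>\<^sub>v v" "w = (b \<cdot>\<^sub>v v + w) - b \<cdot>\<^sub>v v"
      using eV v by (auto intro!: eq_vecI)
    then show "a = b \<and> u = w"
      using *(3) \<open>a = b\<close> by metis
  qed
  then show ?thesis
    unfolding adjoin_def by (simp add: card_image card_cartesian_product card_field)
qed

lemma perp_adjoin:
  assumes "is_subspace W" "v \<in> V"
  shows "perp (adjoin W v) = {e \<in> perp W. B e v = 0}"
proof
  show "perp (adjoin W v) \<subseteq> {e \<in> perp W. B e v = 0}"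
    using assms adjoin_superset adjoin_member by (auto simp: perp_def)
  show "{e \<in> perp W. B e v = 0} \<subseteq> perp (adjoin W v)"
    using assms by (auto simp: perp_def adjoin_def form_simps subspace_carrier)
qed

subsection \<open>The unitary group\<close>

text \<open>This is the matrix of the map sending \<open>x\<close> to \<open>x + a * B x d\<close>
  times \<open>d\<close>; its columns are the images of the unit vectors. Suitable \<open>a\<close>
  yield unitary reflections when \<open>B d d\<close> is nonzero and transvections when it
  vanishes.\<close>

definition quasi_refl :: "'a \<Rightarrow> 'a vec \<Rightarrow> 'a mat" where
  "quasi_refl a d = mat n n (\<lambda>(i, j). (if i = j then 1 else 0) + a * B (unit_vec n j) d * d $ i)"

lemma quasi_refl_carrier: "quasi_refl a d \<in> carrier_mat n n"
  by (simp add: quasi_refl_def)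

lemma quasi_refl_mult_vec:
  assumes "x \<in> V" "d \<in> V"
  shows "quasi_refl a d *\<^sub>v x = x + (a * B x d) \<cdot>\<^sub>v d"
proof (intro eq_vecI)
  fix i assume "i < dim_vec (x + (a * B x d) \<cdot>\<^sub>v d)"
  then have i: "i < n"
    using assms by simp
  \<comment> \<open>Linearity in the first argument recovers \<open>B x d\<close> from the values on
    unit vectors stored in the matrix.\<close>
  have "B x d = (\<Sum>j<n. x $ j * B (unit_vec n j) d)"
    using assms by (intro linear_functional_expand) (auto simp: form_simps)
  have "(quasi_refl a d *\<^sub>v x) $ i
      = (\<Sum>j<n. ((if i = j then 1 else 0) + a * B (unit_vec n j) d * d $ i) * x $ j)"
    using i assms by (simp add: quasi_refl_def scalar_prod_def lessThan_atLeast0)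
  also have "\<dots> = (\<Sum>j<n. if i = j then x $ j else 0) + (\<Sum>j<n. a * d $ i * (x $ j * B (unit_vec n j) d))"
    unfolding sum.distrib[symmetric] by (intro sum.cong) (auto simp: algebra_simps)
  also have "\<dots> = x $ i + a * d $ i * B x d"
    using i \<open>B x d = _\<close> by (simp add: sum_distrib_left)
  finally show "(quasi_refl a d *\<^sub>v x) $ i = (x + (a * B x d) \<cdot>\<^sub>v d) $ i"
    using i assms by (simp add: mult_ac)
qed (use assms in \<open>simp add: quasi_refl_def\<close>)

text \<open>A vector in the kernel of an isometry is orthogonal to everything, hence zero by
  nondegeneracy; so the determinant is nonzero and invertibility comes for free.\<close>

lemma isometry_in_unitary_group:
  assumes g: "g \<in> carrier_mat n n"
    and iso: "\<And>v w. v \<in> V \<Longrightarrow> w \<in> V \<Longrightarrow> B (g *\<^sub>v v) (g *\<^sub>v w) = B v w"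
  shows "g \<in> unitary_group n B"
proof -
  have "v = 0\<^sub>v n" if v: "v \<in> V" "g *\<^sub>v v = 0\<^sub>v n" for v
  proof -
    have "B v w = 0" if "w \<in> V" for w
      using iso[OF v(1) that] v(2) that g by (simp add: form_zero_left)
    then show ?thesis
      using v nondegenerate by (auto simp: nondegenerate_form_def)
  qed
  then have "det g \<noteq> 0"
    using det_0_iff_vec_prod_zero_field[OF g] by blast
  then have "g \<in> Units (ring_mat TYPE('a) n ())"
    by (rule det_non_zero_imp_unit[OF g])
  then have "invertible_mat g"
    using g by (auto simp: Units_def ring_mat_def invertible_mat_def inverts_mat_def)
  then show ?thesis
    using g iso by (simp add: unitary_group_def)
qed

lemma unitary_carrier: "g \<in> unitary_group n B \<Longrightarrow> g \<in> carrier_mat n n"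
  and unitary_form: "\<lbrakk>g \<in> unitary_group n B; v \<in> V; w \<in> V\<rbrakk> \<Longrightarrow> B (g *\<^sub>v v) (g *\<^sub>v w) = B v w"
  by (auto simp: unitary_group_def)

lemma unitary_mult_vec_carrier: "\<lbrakk>g \<in> unitary_group n B; v \<in> V\<rbrakk> \<Longrightarrow> g *\<^sub>v v \<in> V"
  using mult_mat_vec_carrier[OF unitary_carrier] by blast

lemma unitary_one: "1\<^sub>m n \<in> unitary_group n B"
  by (rule isometry_in_unitary_group) auto

lemma unitary_mult:
  assumes "g \<in> unitary_group n B" "h \<in> unitary_group n B"
  shows "g * h \<in> unitary_group n B"
  using assms unitary_carrier[OF assms(1)] unitary_carrier[OF assms(2)]
  by (intro isometry_in_unitary_group)
     (auto simp: assoc_mult_mat_vec[of _ n n _ n] unitary_form unitary_mult_vec_carrier)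

lemma unitary_inverse:
  assumes g: "g \<in> unitary_group n B"
  obtains h where "h \<in> unitary_group n B" "g * h = 1\<^sub>m n" "h * g = 1\<^sub>m n"
proof -
  have gc: "g \<in> carrier_mat n n"
    using g by (rule unitary_carrier)
  obtain h where h: "g * h = 1\<^sub>m n" "h * g = 1\<^sub>m (dim_row h)"
    using g gc by (auto simp: unitary_group_def invertible_mat_def inverts_mat_def)
  have hc: "h \<in> carrier_mat n n"
    using h gc by (metis carrier_matD(2) carrier_matI index_mult_mat(2,3) index_one_mat(2,3))
  have "B (h *\<^sub>v v) (h *\<^sub>v w) = B v w" if "v \<in> V" "w \<in> V" for v w
  proof -
    have "g *\<^sub>v (h *\<^sub>v v) = v" "g *\<^sub>v (h *\<^sub>v w) = w"
      using that by (simp_all add: h(1) flip: assoc_mult_mat_vec[OF gc hc])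
    then show ?thesis
      using unitary_form[OF g, of "h *\<^sub>v v" "h *\<^sub>v w"] that hc by auto
  qed
  then have "h \<in> unitary_group n B"
    using hc by (intro isometry_in_unitary_group)
  then show ?thesis
    using that h hc by auto
qed

lemma finite_unitary_group: "finite (unitary_group n B)"
proof -
  have "unitary_group n B \<subseteq> mat_of_rows n ` {vs. set vs \<subseteq> V \<and> length vs = n}"
  proof
    fix g assume "g \<in> unitary_group n B"
    then have g: "g \<in> carrier_mat n n"
      by (rule unitary_carrier)
    then have "g = mat_of_rows n (Matrix.rows g)"
      by (metis carrier_matD(2) mat_of_rows_rows)
    moreover have "set (Matrix.rows g) \<subseteq> V" "length (Matrix.rows g) = n"
      using g rows_carrier[of g] by auto
    ultimately show "g \<in> mat_of_rows n ` {vs. set vs \<subseteq> V \<and> length vs = n}"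
      by blast
  qed
  then show ?thesis
    by (rule finite_subset) (simp add: finite_lists_length_eq)
qed

text \<open>Expanding the form on two images leaves \<open>B v w\<close> plus a multiple of
  \<open>B v d * B d w\<close>, and the condition on \<open>a\<close> says that this coefficient
  vanishes.\<close>

lemma quasi_refl_unitary:
  assumes d: "d \<in> V" and a: "a + a ^ q + a * a ^ q * B d d = 0"
  shows "quasi_refl a d \<in> unitary_group n B"
proof (rule isometry_in_unitary_group[OF quasi_refl_carrier])
  fix v w assume vw: "v \<in> V" "w \<in> V"
  have c: "B w d ^ q = B d w"
    using vw d by (simp flip: form_conj)
  have "B (quasi_refl a d *\<^sub>v v) (quasi_refl a d *\<^sub>v w)
      = B v w + (a + a ^ q + a * a ^ q * B d d) * (B v d * B d w)"
    using vw d by (simp add: quasi_refl_mult_vec form_simps power_mult_distrib c algebra_simps)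
  then show "B (quasi_refl a d *\<^sub>v v) (quasi_refl a d *\<^sub>v w) = B v w"
    using a by simp
qed

section \<open>Pointwise stabilizers of subspaces\<close>

definition fixer :: "'a vec set \<Rightarrow> 'a mat set" where
  "fixer W = {g \<in> unitary_group n B. \<forall>w\<in>W. g *\<^sub>v w = w}"

lemma fixer_mult:
  assumes "W \<subseteq> V" "g \<in> fixer W" "h \<in> fixer W"
  shows "g * h \<in> fixer W"
  using assms unitary_carrier
  by (auto simp: fixer_def unitary_mult assoc_mult_mat_vec[of _ n n _ n] subset_iff)

lemma fixer_inverse:
  assumes "W \<subseteq> V" "g \<in> fixer W"
  obtains h where "h \<in> fixer W" "g * h = 1\<^sub>m n" "h * g = 1\<^sub>m n"
proof -
  have g: "g \<in> unitary_group n B"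
    using assms by (simp add: fixer_def)
  then obtain h where h: "h \<in> unitary_group n B" "g * h = 1\<^sub>m n" "h * g = 1\<^sub>m n"
    by (rule unitary_inverse)
  have "h *\<^sub>v w = w" if "w \<in> W" for w
  proof -
    have "w \<in> V" "g *\<^sub>v w = w"
      using that assms by (auto simp: fixer_def)
    then have "h *\<^sub>v w = (h * g) *\<^sub>v w"
      using assoc_mult_mat_vec[OF unitary_carrier[OF h(1)] unitary_carrier[OF g]] by simp
    then show ?thesis
      using h(3) \<open>w \<in> V\<close> by simp
  qed
  then have "h \<in> fixer W"
    using h(1) by (simp add: fixer_def)
  then show ?thesis
    using that h(2,3) by blast
qed

lemma finite_fixer: "finite (fixer W)"
  using finite_unitary_group by (auto simp: fixer_def)

lemma fixer_singleton_zero: "fixer {0\<^sub>v n} = unitary_group n B"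
proof -
  have "g *\<^sub>v 0\<^sub>v n = 0\<^sub>v n" if "g \<in> unitary_group n B" for g
    using unitary_carrier[OF that] by (intro eq_vecI) auto
  then show ?thesis
    by (auto simp: fixer_def)
qed

lemma fixer_adjoin:
  assumes "is_subspace W" "v \<in> V"
  shows "fixer (adjoin W v) = {g \<in> fixer W. g *\<^sub>v v = v}"
proof
  show "fixer (adjoin W v) \<subseteq> {g \<in> fixer W. g *\<^sub>v v = v}"
    using assms adjoin_superset adjoin_member by (auto simp: fixer_def)
  show "{g \<in> fixer W. g *\<^sub>v v = v} \<subseteq> fixer (adjoin W v)"
  proof
    fix g assume g: "g \<in> {g \<in> fixer W. g *\<^sub>v v = v}"
    then have gc: "g \<in> carrier_mat n n"
      using unitary_carrier by (auto simp: fixer_def)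
    have "g *\<^sub>v (a \<cdot>\<^sub>v v + w) = a \<cdot>\<^sub>v v + w" if "w \<in> W" for a w
      using g that assms gc subspace_carrier[OF assms(1) that]
      by (auto simp: fixer_def mult_add_distrib_mat_vec[of _ n n] mult_mat_vec[of _ n n])
    then show "g \<in> fixer (adjoin W v)"
      using g by (auto simp: fixer_def adjoin_def)
  qed
qed

text \<open>The fibres of the orbit map are cosets of the stabilizer of \<open>v\<close>: left
  multiplication by the inverse of one element of a fibre carries it onto the stabilizer.\<close>

lemma orbit_stabilizer:
  assumes W: "is_subspace W" and v: "v \<in> V"
  shows "card (fixer W) = card {g \<in> fixer W. g *\<^sub>v v = v} * card ((\<lambda>g. g *\<^sub>v v) ` fixer W)"
proof (rule card_fibres[OF finite_fixer])
  have WV: "W \<subseteq> V"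
    using W by (simp add: is_subspace_def)
  fix y assume "y \<in> (\<lambda>g. g *\<^sub>v v) ` fixer W"
  then obtain g where g: "g \<in> fixer W" "y = g *\<^sub>v v"
    by blast
  obtain h where h: "h \<in> fixer W" "g * h = 1\<^sub>m n" "h * g = 1\<^sub>m n"
    by (rule fixer_inverse[OF WV g(1)])
  have c: "x \<in> carrier_mat n n" if "x \<in> fixer W" for x
    using that unitary_carrier by (simp add: fixer_def)
  have "bij_betw (\<lambda>x. h * x) {x \<in> fixer W. x *\<^sub>v v = y} {x \<in> fixer W. x *\<^sub>v v = v}"
  proof (rule bij_betw_byWitness[where f' = "\<lambda>x. g * x"])
    have "g * (h * x) = x" "h * (g * x) = x" if "x \<in> fixer W" for x
      using assoc_mult_mat[OF c[OF g(1)] c[OF h(1)] c[OF that]]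
        assoc_mult_mat[OF c[OF h(1)] c[OF g(1)] c[OF that]] h(2,3) c[OF that]
      by simp_all
    then show "\<forall>x\<in>{x \<in> fixer W. x *\<^sub>v v = y}. g * (h * x) = x"
      and "\<forall>x\<in>{x \<in> fixer W. x *\<^sub>v v = v}. h * (g * x) = x"
      by auto
    have "h *\<^sub>v y = v"
      using g(2) h(3) v by (simp flip: assoc_mult_mat_vec[OF c[OF h(1)] c[OF g(1)]])
    then show "(\<lambda>x. h * x) ` {x \<in> fixer W. x *\<^sub>v v = y} \<subseteq> {x \<in> fixer W. x *\<^sub>v v = v}"
      using v c h(1) fixer_mult[OF WV] by (auto simp: assoc_mult_mat_vec[of _ n n _ n])
    show "(\<lambda>x. g * x) ` {x \<in> fixer W. x *\<^sub>v v = v} \<subseteq> {x \<in> fixer W. x *\<^sub>v v = y}"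
      using v c g fixer_mult[OF WV] by (auto simp: assoc_mult_mat_vec[of _ n n _ n])
  qed
  then show "card {x \<in> fixer W. x *\<^sub>v v = y} = card {x \<in> fixer W. x *\<^sub>v v = v}"
    by (rule bij_betw_same_card)
qed

subsection \<open>Orbits and moments\<close>

lemma witt_generic:
  assumes W: "is_subspace W" and v: "v \<in> V" "v' \<in> V"
    and d: "v' - v \<in> perp W" and norm: "B v' v' = B v v" and nonzero: "B v (v' - v) \<noteq> 0"
  shows "\<exists>g\<in>fixer W. g *\<^sub>v v = v'"
proof -
  define d where "d = v' - v"
  \<comment> \<open>The only coefficient for which the quasi-reflection along \<open>d\<close> sends
    \<open>v\<close> to \<open>v + d\<close>. It fixes \<open>W\<close> because \<open>d\<close> is
    orthogonal to \<open>W\<close>.\<close>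
  define a where "a = inverse (B v d)"
  have dV: "d \<in> V" and v': "v' = v + d"
    using v by (auto simp: d_def intro!: eq_vecI)
  have conj: "B v d ^ q = B d v"
    using v dV by (simp flip: form_conj)
  have sum0: "B v d + B d v + B d d = 0"
    using norm v dV unfolding v' by (simp add: form_simps add_ac)
  have as: "a * B v d = 1"
    using nonzero by (simp add: a_def d_def)
  then have "(a * B v d) ^ q = 1"
    by simp
  then have as': "a ^ q * B d v = 1"
    by (simp add: power_mult_distrib conj)
  \<comment> \<open>Each of the three summands on the right vanishes, the last one because
    \<open>v\<close> and \<open>v'\<close> have equal norms.\<close>
  have "a + a ^ q + a * a ^ q * B d d
      = a * (1 - a ^ q * B d v) + a ^ q * (1 - a * B v d) + a * a ^ q * (B v d + B d v + B d d)"
    by (simp add: algebra_simps)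
  then have "quasi_refl a d \<in> unitary_group n B"
    using dV by (intro quasi_refl_unitary) (simp_all add: as as' sum0)
  moreover have "quasi_refl a d *\<^sub>v w = w" if "w \<in> W" for w
  proof -
    have "w \<in> V" "B w d = 0"
      using that W d perp_form_right subspace_carrier by (auto simp: d_def)
    then show ?thesis
      using dV by (auto simp: quasi_refl_mult_vec intro!: eq_vecI)
  qed
  moreover have "quasi_refl a d *\<^sub>v v = v'"
    using v dV as by (simp add: quasi_refl_mult_vec v')
  ultimately show ?thesis
    by (auto simp: fixer_def)
qed

text \<open>A space is not the union of two proper subspaces: if \<open>x\<close> detects only
  \<open>v\<close> and \<open>y\<close> detects only \<open>v'\<close>, then \<open>x + y\<close>
  detects both.\<close>

lemma obtain_perp2:
  assumes "is_subspace W" "v \<in> V" "v \<notin> W" "v' \<in> V" "v' \<notin> W"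
  obtains e where "e \<in> perp W" "B e v \<noteq> 0" "B e v' \<noteq> 0"
proof -
  obtain x where x: "x \<in> perp W" "B x v \<noteq> 0"
    using obtain_perp assms by blast
  obtain y where y: "y \<in> perp W" "B y v' \<noteq> 0"
    using obtain_perp assms by blast
  have V: "x \<in> V" "y \<in> V" "is_subspace (perp W)"
    using x y perp_carrier assms(1) subspace_perp by (auto simp: is_subspace_def)
  show ?thesis
  proof (cases "B x v' = 0 \<and> B y v = 0")
    case True
    then have "B (x + y) v \<noteq> 0" "B (x + y) v' \<noteq> 0"
      using V x y assms by (simp_all add: form_simps)
    then show ?thesis
      using that x y V subspace_add by blast
  next
    case False
    then show ?thesis
      using that x y by blast
  qed
qed

text \<open>When \<open>B v (v' - v) = 0\<close>, no single quasi-reflection maps \<open>v\<close> to \<open>v'\<close>, but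
  one maps \<open>v\<close> to \<open>v + e\<close> and another one maps \<open>v + e\<close> to \<open>v'\<close>, for suitable \<open>e\<close>.\<close>

lemma witt:
  assumes W: "is_subspace W" and v: "v \<in> V" "v \<notin> W" and v': "v' \<in> V" "v' \<notin> W"
    and d: "v' - v \<in> perp W" and norm: "B v' v' = B v v"
  shows "\<exists>g\<in>fixer W. g *\<^sub>v v = v'"
proof (cases "B v (v' - v) = 0")
  case False
  then show ?thesis
    using witt_generic assms by blast
next
  case True
  have WV: "W \<subseteq> V" and sub: "is_subspace (perp W)"
    using W subspace_perp by (auto simp: is_subspace_def)
  obtain e0 where e0: "e0 \<in> perp W" "B e0 v \<noteq> 0" "B e0 v' \<noteq> 0"
    using obtain_perp2 W v v' by blast
  have e0V: "e0 \<in> V"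
    using e0 perp_carrier by blast
  define s where "s = B e0 v"
  define c where "c = B e0 e0"
  have "- c \<in> F"
    using form_self_in_F[OF e0V] by (simp add: F_def c_def conj_minus)
  then have "\<not> {r. r + r ^ q = - c} \<subseteq> {0}"
    using card_trace_fibre[of "- c"] q_ge_2 card_mono[of "{0 :: 'a}" "{r. r + r ^ q = - c}"] by auto
  \<comment> \<open>The trace fibre over \<open>- c\<close> has \<open>q\<close> elements, hence
    more than one, so it contains a nonzero element.\<close>
  then obtain y where y: "y + y ^ q = - c" "y \<noteq> 0"
    by auto
  \<comment> \<open>For \<open>t\<close> times \<open>e0\<close> to preserve the norm of
    \<open>v\<close> when added, \<open>t_eq\<close> must hold. Divided by \<open>t * t ^ q\<close>,
    it says that \<open>s ^ q / t\<close> has trace \<open>- c\<close>; so \<open>t\<close> is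
    solved from \<open>y = s ^ q / t\<close>.\<close>
  define t where "t = s ^ q / y"
  have t: "t \<noteq> 0"
    using e0 y by (simp add: t_def s_def)
  have tq: "t ^ q = s / y ^ q"
    by (simp add: t_def power_divide conj_conj)
  have t_eq: "t * s + t ^ q * s ^ q + t * t ^ q * c = 0"
  proof -
    have "t * s + t ^ q * s ^ q + t * t ^ q * c = s ^ q / y * s + s / y ^ q * s ^ q + s ^ q / y * (s / y ^ q) * c"
      by (simp only: tq) (simp only: t_def)
    also have "\<dots> = s * s ^ q * (y + y ^ q + c) / (y * y ^ q)"
      using y(2) by (simp add: field_simps)
    finally show ?thesis
      using y(1) by simp
  qed
  define e where "e = t \<cdot>\<^sub>v e0"
  have e: "e \<in> perp W" "e \<in> V"
    using subspace_smult[OF sub e0(1)] e0V by (auto simp: e_def)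
  have B_e_v: "B e v = t * s" and B_v_e: "B v e = t ^ q * s ^ q" and B_e_e: "B e e = t * t ^ q * c"
    using e0V v form_conj[OF e0V v(1)] by (auto simp: e_def form_simps s_def c_def)
  have norm_e: "B v e + B e v + B e e = 0"
    using t_eq by (simp add: B_e_v B_v_e B_e_e add_ac)
  have "\<exists>g\<in>fixer W. g *\<^sub>v v = v + e"
  proof (rule witt_generic[OF W v(1)])
    have ve: "v + e - v = e"
      using v e by (intro eq_vecI) auto
    show "v + e \<in> V" "v + e - v \<in> perp W"
      using v e ve by auto
    show "B (v + e) (v + e) = B v v"
      using v e norm_e by (simp add: form_simps add_ac)
    show "B v (v + e - v) \<noteq> 0"
      unfolding ve B_v_e using t e0 by (simp add: s_def)
  qed
  then obtain g where g: "g \<in> fixer W" "g *\<^sub>v v = v + e"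
    by blast
  have "\<exists>h\<in>fixer W. h *\<^sub>v (v + e) = v'"
  proof (rule witt_generic[OF W _ v'(1)])
    show "v + e \<in> V"
      using v e by auto
    have "v' - (v + e) = (v' - v) - e"
      using v v' e by (intro eq_vecI) auto
    then show "v' - (v + e) \<in> perp W"
      using subspace_diff[OF sub d e(1)] by simp
    show "B v' v' = B (v + e) (v + e)"
      using v e norm_e by (simp add: form_simps norm add_ac)
    \<comment> \<open>The first term vanishes by the case assumption and the bracket by
      \<open>norm_e\<close>. What remains is nonzero because \<open>e0\<close> was chosen to detect
      \<open>v'\<close> as well as \<open>v\<close>.\<close>
    have "B (v + e) (v' - (v + e)) = B v (v' - v) + B e v' - (B v e + B e v + B e e)"
      using v v' e by (simp add: form_simps form_diff_right algebra_simps)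
    also have "\<dots> = t * B e0 v'"
      using True norm_e e0V v' by (simp add: e_def form_simps)
    finally show "B (v + e) (v' - (v + e)) \<noteq> 0"
      using t e0 by simp
  qed
  then obtain h where h: "h \<in> fixer W" "h *\<^sub>v (v + e) = v'"
    by blast
  have "h \<in> carrier_mat n n" "g \<in> carrier_mat n n"
    using g h unitary_carrier by (auto simp: fixer_def)
  then have "(h * g) *\<^sub>v v = v'"
    using assoc_mult_mat_vec[of h n n g n v] v g h by simp
  then show ?thesis
    using fixer_mult[OF WV h(1) g(1)] by blast
qed

text \<open>Isometries fixing \<open>W\<close> preserve the norm and the pairings with
  \<open>W\<close>, and \<open>witt\<close> gives the converse. Vectors of \<open>W\<close> must be
  excluded: zero, for instance, shares these invariants with any isotropic \<open>v\<close> in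
  \<open>perp W\<close>.\<close>

lemma orbit_eq:
  assumes W: "is_subspace W" and v: "v \<in> V" "v \<notin> W"
  shows "(\<lambda>g. g *\<^sub>v v) ` fixer W = {v' \<in> V - W. v' - v \<in> perp W \<and> B v' v' = B v v}"
proof
  show "{v' \<in> V - W. v' - v \<in> perp W \<and> B v' v' = B v v} \<subseteq> (\<lambda>g. g *\<^sub>v v) ` fixer W"
    using witt[OF W v] by blast
  show "(\<lambda>g. g *\<^sub>v v) ` fixer W \<subseteq> {v' \<in> V - W. v' - v \<in> perp W \<and> B v' v' = B v v}"
  proof clarify
    fix g assume g: "g \<in> fixer W"
    then have gU: "g \<in> unitary_group n B"
      by (simp add: fixer_def)
    have gv: "g *\<^sub>v v \<in> V"
      using unitary_mult_vec_carrier gU v by blast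
    have WV: "W \<subseteq> V"
      using W by (simp add: is_subspace_def)
    have "g *\<^sub>v v \<notin> W"
    proof
      assume "g *\<^sub>v v \<in> W"
      obtain h where h: "h \<in> fixer W" "h * g = 1\<^sub>m n"
        by (rule fixer_inverse[OF WV g])
      have "h *\<^sub>v (g *\<^sub>v v) = v"
        using assoc_mult_mat_vec[of h n n g n v] h v unitary_carrier gU by (simp add: fixer_def)
      moreover have "h *\<^sub>v (g *\<^sub>v v) = g *\<^sub>v v"
        using h(1) \<open>g *\<^sub>v v \<in> W\<close> by (simp add: fixer_def)
      ultimately show False
        using v(2) \<open>g *\<^sub>v v \<in> W\<close> by simp
    qed
    moreover have "g *\<^sub>v v - v \<in> perp W"
    proof -
      have "B (g *\<^sub>v v - v) w = 0" if "w \<in> W" for w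
      proof -
        have "w \<in> V" "g *\<^sub>v w = w"
          using that WV g by (auto simp: fixer_def)
        then show ?thesis
          using unitary_form[OF gU v(1), of w] gv v by (simp add: form_diff_left)
      qed
      then show ?thesis
        using gv v by (simp add: perp_def)
    qed
    ultimately show "g *\<^sub>v v \<in> V - W \<and> g *\<^sub>v v - v \<in> perp W \<and> B (g *\<^sub>v v) (g *\<^sub>v v) = B v v"
      using gv unitary_form[OF gU v(1) v(1)] by simp
  qed
qed

section \<open>Vectors outside the subspace with prescribed invariants\<close>

lemma obtain_isotropic:
  assumes W: "is_subspace W" and card: "card W = q ^ (2 * k)" and n: "2 * (k + 1) \<le> n"
  obtains u where "u \<in> perp W" "u \<notin> W" "B u u = 0"
proof -
  have finW: "finite W" "W \<subseteq> V"
    using W subspace_finite by (auto simp: is_subspace_def)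
  have sub: "is_subspace (perp W)"
    using finW subspace_perp by simp
  \<comment> \<open>In terms of dimensions: the complement of a space of dimension at most
    \<open>k + 1\<close> has dimension at least \<open>n - k - 1\<close>, which exceeds
    \<open>k\<close>, so it does not fit into \<open>W\<close>. This is where the bound on
    \<open>n\<close> enters.\<close>
  have outside: "\<exists>e. e \<in> perp W' \<and> e \<notin> W" if "is_subspace W'" "card W' \<le> q ^ (2 * k + 2)" for W'
  proof (rule ccontr)
    assume "\<not> ?thesis"
    then have "card (perp W') \<le> card W"
      using finW by (intro card_mono) auto
    then have "card W' * card (perp W') \<le> q ^ (2 * k + 2) * q ^ (2 * k)"
      unfolding card by (intro mult_mono that) auto
    also have "\<dots> = q ^ (2 * k + 2 + 2 * k)"
      by (rule power_add[symmetric])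
    also have "2 * k + 2 + 2 * k = 4 * k + 2"
      by simp
    finally have "q ^ (2 * n) \<le> q ^ (4 * k + 2)"
      using card_perp[OF that(1)] by (simp only: card_V)
    then have "2 * n \<le> 4 * k + 2"
      by (rule power_le_imp_le_exp[rotated]) (use q_ge_2 in simp)
    then show False
      using n by simp
  qed
  have "card W \<le> q ^ (2 * k + 2)"
    unfolding card using q_ge_2 by (intro power_increasing) auto
  then obtain e1 where e1: "e1 \<in> perp W" "e1 \<notin> W"
    using outside[OF W] by blast
  then have e1V: "e1 \<in> V"
    using perp_carrier by blast
  show ?thesis
  proof (cases "B e1 e1 = 0")
    case True
    then show ?thesis using that e1 by blast
  next
    case False
    have "card (adjoin W e1) = q ^ (2 * k + 2)"
      using card_adjoin[OF W e1V e1(2)] by (simp add: card power_add power2_eq_square)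
    then obtain e2 where e2: "e2 \<in> perp (adjoin W e1)" "e2 \<notin> W"
      using outside[OF subspace_adjoin[OF W e1V]] by auto
    then have e2': "e2 \<in> perp W" "B e2 e1 = 0"
      using perp_adjoin[OF W e1V] by auto
    then have e2V: "e2 \<in> V" and sym: "B e1 e2 = 0"
      using perp_carrier form_eq_zero_sym e1V by blast+
    show ?thesis
    proof (cases "B e2 e2 = 0")
      case True
      then show ?thesis using that e2' e2 by blast
    next
      case nz: False
      have "- B e1 e1 / B e2 e2 \<in> F"
        using form_self_in_F[OF e1V] form_self_in_F[OF e2V]
        by (simp add: F_def power_divide conj_minus)
      then obtain t where t: "t * t ^ q = - B e1 e1 / B e2 e2"
        by (rule norm_surj)
      \<comment> \<open>The norms of the orthogonal vectors \<open>e1\<close> and \<open>e2\<close>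
        add up, and \<open>t\<close> makes them cancel. Since \<open>B u e1 = B e1 e1\<close> is
        nonzero and \<open>e1\<close> is orthogonal to \<open>W\<close>, the vector \<open>u\<close>
        lies outside \<open>W\<close>.\<close>
      define u where "u = e1 + t \<cdot>\<^sub>v e2"
      have "u \<in> perp W"
        using subspace_add[OF sub e1(1) subspace_smult[OF sub e2'(1)]] by (simp add: u_def)
      moreover have "B u u = B e1 e1 + t * t ^ q * B e2 e2"
        using e1V e2V e2' sym by (simp add: u_def form_simps)
      then have "B u u = 0"
        using nz by (simp add: t)
      moreover have "B u e1 \<noteq> 0"
        using e1V e2V e2' False by (simp add: u_def form_simps)
      then have "u \<notin> W"
        using perp_form_right[OF e1(1)] finW by blast
      ultimately show ?thesis
        using that by blast
    qed
  qed
qed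

text \<open>Adding vectors of \<open>perp W\<close> does not change the functional on
  \<open>W\<close>. First \<open>x\<close> is moved to some \<open>x'\<close> not orthogonal to an
  isotropic \<open>u\<close>; adding \<open>b\<close> times \<open>u\<close> then changes the norm
  by the trace of \<open>b * B u x'\<close>, which can be any element of \<open>F\<close>.\<close>

lemma obtain_norm:
  assumes W: "is_subspace W" and card: "card W = q ^ (2 * k)" and n: "2 * (k + 1) \<le> n"
    and x: "x \<in> V" and c: "c \<in> F"
  obtains v where "v \<in> V" "v \<notin> W" "v - x \<in> perp W" "B v v = c"
proof -
  have sub: "is_subspace (perp W)" and WV: "W \<subseteq> V"
    using W subspace_perp by (auto simp: is_subspace_def)
  obtain u where u: "u \<in> perp W" "u \<notin> W" "B u u = 0"
    using obtain_isotropic[OF W card n] by blast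
  then have uV: "u \<in> V"
    using perp_carrier by blast
  obtain z where z: "z \<in> perp W" "B u z \<noteq> 0"
    using obtain_perp[OF W uV u(2)] form_eq_zero_sym uV perp_carrier by metis
  then have zV: "z \<in> V"
    using perp_carrier by blast
  obtain y where y: "y \<in> perp W" "B u (x + y) \<noteq> 0"
  proof (cases "B u x = 0")
    case True
    then show ?thesis
      using that[OF z(1)] z(2) uV x zV by (simp add: form_simps)
  next
    case False
    then show ?thesis
      using that[OF subspace_zero[OF sub]] uV x by (simp add: form_simps form_zero_right)
  qed
  define x' where "x' = x + y"
  have yV: "y \<in> V" and x'V: "x' \<in> V" and s: "B u x' \<noteq> 0"
    using y perp_carrier x by (auto simp: x'_def)
  have "c - B x' x' \<in> F"
    using c form_self_in_F[OF x'V] conj_add[of "c" "- B x' x'"] by (simp add: F_def conj_minus)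
  then obtain b where b: "b * B u x' + (b * B u x') ^ q = c - B x' x'"
    using trace_surj[OF _ s] by blast
  define v where "v = x' + b \<cdot>\<^sub>v u"
  have vV: "v \<in> V"
    using x'V uV by (simp add: v_def)
  have "B v v = B x' x' + (b * B u x' + (b * B u x') ^ q)"
    using x'V uV u(3) form_conj[OF uV x'V] by (simp add: v_def form_simps power_mult_distrib)
  then have "B v v = c"
    by (simp add: b)
  moreover have "B u v \<noteq> 0"
    using x'V uV u(3) s by (simp add: v_def form_simps)
  then have "v \<notin> W"
    using perp_form_left[OF u(1)] by blast
  moreover have "v - x = y + b \<cdot>\<^sub>v u"
    using x yV uV by (intro eq_vecI) (auto simp: v_def x'_def)
  then have "v - x \<in> perp W"
    using subspace_add[OF sub y(1) subspace_smult[OF sub u(1)]] by simp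
  ultimately show ?thesis
    using that vV by blast
qed

section \<open>Counting the orbits outside the subspace\<close>

definition restrict_form :: "'a vec set \<Rightarrow> 'a vec \<Rightarrow> 'a vec \<Rightarrow> 'a" where
  "restrict_form W v = (\<lambda>w. if w \<in> W then B v w else 0)"

text \<open>The default value 0 off \<open>W\<close> makes equality of functions mean equality of
  the functionals on \<open>W\<close>.\<close>

lemma restrict_form_eq_iff:
  assumes "W \<subseteq> V" "v \<in> V" "v' \<in> V"
  shows "restrict_form W v' = restrict_form W v \<longleftrightarrow> v' - v \<in> perp W"
  using assms by (auto simp: restrict_form_def perp_def fun_eq_iff form_diff_left subset_iff)

text \<open>The fibres of the restriction map are cosets of \<open>perp W\<close>, so
  \<open>card_perp\<close> gives the number of its values.\<close>

lemma card_restrict_form: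
  assumes W: "is_subspace W"
  shows "card (restrict_form W ` V) = card W"
proof -
  have WV: "W \<subseteq> V" and sub: "is_subspace (perp W)"
    using W subspace_perp by (auto simp: is_subspace_def)
  have "card V = card (perp W) * card (restrict_form W ` V)"
  proof (rule card_fibres)
    show "finite V" by simp
    fix f assume "f \<in> restrict_form W ` V"
    then obtain x where x: "x \<in> V" "f = restrict_form W x"
      by blast
    have "bij_betw (\<lambda>v. v - x) {v \<in> V. restrict_form W v = f} (perp W)"
    proof (rule bij_betw_byWitness[where f' = "\<lambda>v. v + x"])
      show "\<forall>v\<in>{v \<in> V. restrict_form W v = f}. v - x + x = v"
        using x by (auto simp: diff_add_cancel_vec)
      show "\<forall>v\<in>perp W. v + x - x = v"
        using x perp_carrier by (auto simp: add_diff_cancel_vec)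
      show "(\<lambda>v. v - x) ` {v \<in> V. restrict_form W v = f} \<subseteq> perp W"
        using x WV by (auto simp: restrict_form_eq_iff)
      show "(\<lambda>v. v + x) ` perp W \<subseteq> {v \<in> V. restrict_form W v = f}"
        using x WV perp_carrier by (auto simp: restrict_form_eq_iff add_diff_cancel_vec)
    qed
    then show "card {v \<in> V. restrict_form W v = f} = card (perp W)"
      by (rule bij_betw_same_card)
  qed
  moreover have "card (perp W) \<noteq> 0"
    using subspace_zero[OF sub] subspace_finite[OF sub] by auto
  ultimately show ?thesis
    using card_perp[OF W] by (metis mult.commute mult_cancel1)
qed

text \<open>The sum counts the orbits outside \<open>W\<close>. They are the fibres of the invariant
  pair \<phi>, whose image is the full product of \<open>q ^ (2 * k)\<close> functionals and
  \<open>q\<close> norms.\<close>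

lemma sum_inverse_orbit_card:
  assumes W: "is_subspace W" and card: "card W = q ^ (2 * k)" and n: "2 * (k + 1) \<le> n"
  shows "(\<Sum>v\<in>V - W. 1 / real (card ((\<lambda>g. g *\<^sub>v v) ` fixer W))) = real q ^ (2 * k + 1)"
proof -
  have WV: "W \<subseteq> V"
    using W by (auto simp: is_subspace_def)
  define \<phi> where "\<phi> v = (restrict_form W v, B v v)" for v
  have "(\<Sum>v\<in>V - W. 1 / real (card ((\<lambda>g. g *\<^sub>v v) ` fixer W)))
      = (\<Sum>v\<in>V - W. 1 / real (card {v' \<in> V - W. \<phi> v' = \<phi> v}))"
  proof (intro sum.cong refl)
    fix v assume v: "v \<in> V - W"
    then have "{v' \<in> V - W. \<phi> v' = \<phi> v} = {v' \<in> V - W. v' - v \<in> perp W \<and> B v' v' = B v v}"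
      using WV by (auto simp: \<phi>_def restrict_form_eq_iff)
    then show "1 / real (card ((\<lambda>g. g *\<^sub>v v) ` fixer W)) = 1 / real (card {v' \<in> V - W. \<phi> v' = \<phi> v})"
      using orbit_eq[OF W] v by simp
  qed
  also have "\<dots> = real (card (\<phi> ` (V - W)))"
    by (rule sum_inverse_fibre_card) simp
  also have "\<phi> ` (V - W) = restrict_form W ` V \<times> F"
  proof
    show "\<phi> ` (V - W) \<subseteq> restrict_form W ` V \<times> F"
      by (auto simp: \<phi>_def form_self_in_F)
    show "restrict_form W ` V \<times> F \<subseteq> \<phi> ` (V - W)"
    proof clarify
      fix x c assume x: "x \<in> V" and "c \<in> F"
      then obtain v where v: "v \<in> V" "v \<notin> W" "v - x \<in> perp W" "B v v = c"
        using obtain_norm[OF W card n] by blast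
      then have "\<phi> v = (restrict_form W x, c)"
        using restrict_form_eq_iff[OF WV x] by (simp add: \<phi>_def)
      then show "(restrict_form W x, c) \<in> \<phi> ` (V - W)"
        using v by (intro image_eqI[of _ _ v]) auto
    qed
  qed
  also have "real (card (restrict_form W ` V \<times> F)) = real q ^ (2 * k + 1)"
    by (simp add: card_cartesian_product card_restrict_form[OF W] card_F card)
  finally show ?thesis .
qed

section \<open>The moment recursion\<close>

lemma sum_fixer_moment:
  assumes "is_subspace W" and "card W = q ^ (2 * k)" and "2 * (k + j) \<le> n"
  shows "(\<Sum>g\<in>fixer W. real (num_fixed_vectors n g) ^ j)
    = real (card (fixer W)) * real q ^ (2 * k * j) * (\<Prod>i=1..j. (real q ^ (2 * i - 1) + 1))"
  using assms
\<comment> \<open>Both \<open>W\<close> and \<open>k\<close> must vary: vectors outside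
  \<open>W\<close> call the hypothesis for \<open>k + 1\<close>, and
  \<open>(k + 1) + j = k + Suc j\<close> keeps the bound on \<open>n\<close> intact.\<close>
proof (induction j arbitrary: W k)
  case 0
  then show ?case by simp
next
  case (Suc j)
  define P where "P = (\<Prod>i=1..j. (real q ^ (2 * i - 1) + 1))"
  define Z where "Z g = real (num_fixed_vectors n g)" for g :: "'a mat"
  have W: "is_subspace W" and card: "card W = q ^ (2 * k)" and n: "2 * (k + 1) \<le> n"
    using Suc.prems by auto
  have WV: "W \<subseteq> V"
    using W by (simp add: is_subspace_def)
  have inner: "(\<Sum>g\<in>{g \<in> fixer W. g *\<^sub>v v = v}. Z g ^ j)
      = (if v \<in> W then real (card (fixer W)) * real q ^ (2 * k * j) * P
         else real (card (fixer W)) * real q ^ (2 * (k + 1) * j) * P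
            * (1 / real (card ((\<lambda>g. g *\<^sub>v v) ` fixer W))))" if v: "v \<in> V" for v
  proof (cases "v \<in> W")
    case True
    then have "{g \<in> fixer W. g *\<^sub>v v = v} = fixer W"
      by (auto simp: fixer_def)
    then show ?thesis
      using True Suc.IH[OF W card] Suc.prems(3) by (simp add: P_def Z_def)
  next
    case False
    have "card (adjoin W v) = q ^ (2 * (k + 1))"
      using card_adjoin[OF W v False] by (simp add: card power_add power2_eq_square)
    then have "(\<Sum>g\<in>fixer (adjoin W v). Z g ^ j)
        = real (card (fixer (adjoin W v))) * real q ^ (2 * (k + 1) * j) * P"
      unfolding P_def Z_def using Suc.prems(3) by (intro Suc.IH[OF subspace_adjoin[OF W v]]) auto
    moreover have "(\<lambda>g. g *\<^sub>v v) ` fixer W \<noteq> {}"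
      using orbit_eq[OF W v False] v False subspace_zero[OF subspace_perp[OF WV]]
        diff_eq_add_smult by (auto intro!: exI[of _ v])
    then have "real (card ((\<lambda>g. g *\<^sub>v v) ` fixer W)) \<noteq> 0"
      using finite_fixer by (simp add: card_eq_0_iff)
    then have "real (card (fixer (adjoin W v)))
        = real (card (fixer W)) * (1 / real (card ((\<lambda>g. g *\<^sub>v v) ` fixer W)))"
      using orbit_stabilizer[OF W v] fixer_adjoin[OF W v] by (simp add: field_simps)
    ultimately show ?thesis
      using False fixer_adjoin[OF W v] by (simp add: mult_ac)
  qed
  \<comment> \<open>One factor \<open>Z g\<close> is spelled out as a sum over the vectors fixed by
    \<open>g\<close>, so that the two summations can be exchanged.\<close>
  have "(\<Sum>g\<in>fixer W. Z g ^ Suc j) = (\<Sum>g\<in>fixer W. \<Sum>v\<in>{v \<in> V. g *\<^sub>v v = v}. Z g ^ j)"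
    by (simp add: Z_def num_fixed_vectors_def)
  also have "\<dots> = (\<Sum>v\<in>V. \<Sum>g\<in>{g \<in> fixer W. g *\<^sub>v v = v}. Z g ^ j)"
    by (intro sum.swap_restrict finite_fixer) simp
  also have "\<dots> = (\<Sum>v\<in>V - W. \<Sum>g\<in>{g \<in> fixer W. g *\<^sub>v v = v}. Z g ^ j)
      + (\<Sum>v\<in>W. \<Sum>g\<in>{g \<in> fixer W. g *\<^sub>v v = v}. Z g ^ j)"
    using WV by (intro sum.subset_diff) auto
  also have "(\<Sum>v\<in>V - W. \<Sum>g\<in>{g \<in> fixer W. g *\<^sub>v v = v}. Z g ^ j)
      = real (card (fixer W)) * real q ^ (2 * (k + 1) * j) * P * real q ^ (2 * k + 1)"
    unfolding sum_inverse_orbit_card[OF W card n, symmetric] sum_distrib_left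
    by (intro sum.cong) (auto simp: inner)
  also have "(\<Sum>v\<in>W. \<Sum>g\<in>{g \<in> fixer W. g *\<^sub>v v = v}. Z g ^ j)
      = real (card W) * (real (card (fixer W)) * real q ^ (2 * k * j) * P)"
    using WV by (simp add: inner subset_iff)
  also have "real (card (fixer W)) * real q ^ (2 * (k + 1) * j) * P * real q ^ (2 * k + 1)
      + real (card W) * (real (card (fixer W)) * real q ^ (2 * k * j) * P)
      = real (card (fixer W)) * real q ^ (2 * k * Suc j) * (P * (real q ^ (2 * Suc j - 1) + 1))"
  proof -
    have "real q ^ (2 * (k + 1) * j) * real q ^ (2 * k + 1) = real q ^ (2 * k * Suc j) * real q ^ (2 * Suc j - 1)"
      unfolding power_add[symmetric] by (rule arg_cong) simp
    moreover have "real (card W) * real q ^ (2 * k * j) = real q ^ (2 * k * Suc j)"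
      by (simp add: card flip: power_add)
    \<comment> \<open>The powers are abstracted to variables, so that the rearrangement relies only
      on the two exponent identities.\<close>
    moreover have "f * a * p * b + w * (f * c * p) = f * d * (p * (e + 1))"
      if "a * b = d * e" "w * c = d" for a b c d e f p w :: real
    proof -
      have "f * a * p * b + w * (f * c * p) = f * p * (a * b) + f * p * (w * c)"
        by (simp add: algebra_simps)
      then show ?thesis
        unfolding that by (simp add: algebra_simps)
    qed
    ultimately show ?thesis
      by blast
  qed
  also have "P * (real q ^ (2 * Suc j - 1) + 1) = (\<Prod>i=1..Suc j. (real q ^ (2 * i - 1) + 1))"
    by (simp add: P_def)
  finally show ?case
    by (simp only: Z_def)
qed

end

theorem theorem4p3:
  fixes B :: "'a::{field,finite} vec \<Rightarrow> 'a vec \<Rightarrow> 'a" and q n j :: nat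
  assumes "primepow q"
    and "CARD('a) = q ^ 2"
    and "hermitian_form q n B"
    and "nondegenerate_form n B"
    and "n \<ge> 2 * j"
  shows "measure_pmf.expectation (pmf_of_set (unitary_group n B))
           (\<lambda>g. real (num_fixed_vectors n g) ^ j)
         = (\<Prod>i=1..j. (real q ^ (2 * i - 1) + 1))"
proof (cases "n = 0")
  case True
  \<comment> \<open>Here \<open>j = 0\<close>, and both sides are 1.\<close>
  then show ?thesis
    using assms(5) by simp
next
  case False
  interpret hermitian_space q n B
    by unfold_locales (use assms False in auto)
  have fin: "unitary_group n B \<noteq> {}" "finite (unitary_group n B)"
    using unitary_one finite_unitary_group by auto
  have "(\<Sum>g\<in>unitary_group n B. real (num_fixed_vectors n g) ^ j)
      = real (card (unitary_group n B)) * (\<Prod>i=1..j. (real q ^ (2 * i - 1) + 1))"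
    \<comment> \<open>The zero subspace has \<open>q ^ 0\<close> elements and is fixed by the whole
      group.\<close>
    using sum_fixer_moment[OF subspace_singleton_zero, of 0 j] assms(5)
    by (simp add: fixer_singleton_zero)
  then show ?thesis
    using fin by (simp add: integral_pmf_of_set)
qed

end
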